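(* Let $n\ge 1$, let $\mathcal N=\{1,\dots,n\}$, and consider the linear time-varying system $x(t+1)=A(t)x(t)$, $t\in\{0,1,2,\dots\}$, where each $A(t)=(a_{i,j}(t))\in\mathbb R^{n\times n}$ is a (row-)stochastic matrix. Assume that, for a given integer $T_d>0$ and given nonnegative real numbers $\alpha,\beta,\gamma$, there exist sets $\mathcal N_0\subset\mathcal N_1\subset\dots\subset\mathcal N_{T_d}=\mathcal N$ with $\mathcal N_0$ a singleton, such that for all $t\ge 0$ and all $k\in\{1,\dots,T_d\}$: \[ a_{i,i}(t)\ge\alpha\ \text{ if } i\in\mathcal N_0,\qquad \sum_{j\in\mathcal N_k\setminus\mathcal N_{k-1}}a_{i,j}(t)\ge\beta\ \text{ if } i\in\mathcal N_k\setminus\mathcal N_{k-1},\qquad \sum_{j\in\mathcal N_{k-1}}a_{i,j}(t)\ge\gamma\ \text{ if } i\in\mathcal N_k\setminus\mathcal N_{k-1}. \] Let $\alpha^\star=\min\{\alpha,\gamma\}$ and $\beta^\star=\min\{\beta+\gamma,\alpha\}-\alpha^\star$. Then the contraction rate $\rho$ of the system satisfies \[ \rho\le\rho_{T_d}(\alpha^\star,\beta^\star):=\lambda_{\max}\big(\zeta_{T_d}(\alpha^\star,\beta^\star)\big). \]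
   Context: A real square matrix is (row-)stochastic if it is (componentwise) nonnegative with each row sum equal to $1$. $\lambda_{\max}(M)$ denotes the spectral radius of the square matrix $M$. The contraction rate of the system $x(t+1)=A(t)x(t)$ is the number $\rho\in[0,1]$ defined by \[ \rho=\sup_{x(0)}\ \limsup_{t\to+\infty}\left(\frac{\max_{i\in\mathcal N}x_i(t)-\min_{i\in\mathcal N}x_i(t)}{\max_{i\in\mathcal N}x_i(0)-\min_{i\in\mathcal N}x_i(0)}\right)^{1/t}, \] where the supremum is over those $x(0)\in\mathbb R^n$ for which the denominator is nonzero. For an integer $T\ge1$ and real $a,b$, $\zeta_T(a,b)\in\mathbb R^{T\times T}$ is the matrix \[ \zeta_T(a,b)=(1-a-b)\,\mathbf 1 e_T^{\mathsf T}+b\,I_T+a\,J_T, \] where $\mathbf 1\in\mathbb R^T$ is the vector with all components $1$, $e_T$ is the last canonical basis vector of $\mathbb R^T$, $I_T$ is the identity, and $J_T$ is the $T\times T$ matrix with ones on the sub-diagonal and zeros elsewhere, i.e. $(J_T)_{i,j}=1$ if $i=j+1$ and $0$ otherwise. *)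

theory Defs
  imports
    "Jordan_Normal_Form.Spectral_Radius"
    "HOL-Library.Extended_Nonnegative_Real"
begin

(* Vectors and matrices are zero-based: the index set {1..n} of the mathematical text is {..<n}. *)

definition row_stochastic :: "nat \<Rightarrow> real mat \<Rightarrow> bool" where
  "row_stochastic n M \<longleftrightarrow> M \<in> carrier_mat n n \<and>
     (\<forall>i<n. \<forall>j<n. 0 \<le> M $$ (i, j)) \<and> (\<forall>i<n. (\<Sum>j<n. M $$ (i, j)) = 1)"

primrec trajectory :: "(nat \<Rightarrow> real mat) \<Rightarrow> real vec \<Rightarrow> nat \<Rightarrow> real vec" where
  "trajectory A x0 0 = x0"
| "trajectory A x0 (Suc t) = A t *\<^sub>v trajectory A x0 t"

definition spread :: "nat \<Rightarrow> real vec \<Rightarrow> real" where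
  "spread n v = (MAX i\<in>{..<n}. v $ i) - (MIN i\<in>{..<n}. v $ i)"

(* The quotients are nonnegative, so ennreal loses nothing. For n = 1 no initial
   condition qualifies, and the supremum of the empty set is 0, the least value
   admissible for a contraction rate. *)
definition contraction_rate :: "nat \<Rightarrow> (nat \<Rightarrow> real mat) \<Rightarrow> ennreal" where
  "contraction_rate n A =
     (SUP x0 \<in> {x0 \<in> carrier_vec n. spread n x0 \<noteq> 0}.
        limsup (\<lambda>t. ennreal ((spread n (trajectory A x0 t) / spread n x0) powr (1 / real t))))"

definition subdiag_mat :: "nat \<Rightarrow> real mat" where
  "subdiag_mat T = mat T T (\<lambda>(i, j). if i = j + 1 then 1 else 0)"

(* The first summand is the column of ones times the row of the last unit vector. *)
definition zeta :: "nat \<Rightarrow> real \<Rightarrow> real \<Rightarrow> real mat" where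
  "zeta T a b =
     (1 - a - b) \<cdot>\<^sub>m (mat_of_cols T [vec T (\<lambda>_. 1)] * mat_of_rows T [unit_vec T (T - 1)])
     + b \<cdot>\<^sub>m 1\<^sub>m T + a \<cdot>\<^sub>m subdiag_mat T"

definition lambda_max :: "real mat \<Rightarrow> real" where
  "lambda_max M = spectral_radius (map_mat complex_of_real M)"

end

theory Submission
  imports Defs
begin

text \<open>
  Let \<open>D k t\<close> be the spread of the state at time \<open>t\<close> over the agents in \<open>N k\<close>. An agent of
  \<open>N k - N (k - 1)\<close> puts weight at least \<open>\<alpha>'\<close> on \<open>N (k - 1)\<close> and at least \<open>\<alpha>' + \<beta>'\<close> on \<open>N k\<close>,
  and the agent of \<open>N 0\<close> puts weight at least \<open>\<alpha>' + \<beta>'\<close> on itself, so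
  \<open>D k (t + 1) \<le> \<alpha>' D (k - 1) t + \<beta>' D k t + (1 - \<alpha>' - \<beta>') D T t\<close> with \<open>D 0 = 0\<close>.
  This says that the vector \<open>(D 1 t, \<dots>, D T t)\<close> is dominated by the linear recursion with
  matrix \<open>zeta T \<alpha>' \<beta>'\<close>, whose growth rate is its spectral radius.
\<close>

section \<open>Growth of nonnegative linear recursions\<close>

lemma spectral_radius_nonneg:
  assumes "A \<in> carrier_mat n n" "n > 0"
  shows "spectral_radius A \<ge> 0"
  using spectral_radius_mem_max(1)[OF assms] by auto

text \<open>If an eigenvalue \<open>k\<close> of maximal modulus is nonzero, then \<open>c\<close>
  is nonzero and \<open>k / c\<close> is an eigenvalue of \<open>A\<close>. The case
  \<open>k = 0\<close> covers \<open>c = 0\<close>.\<close>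

lemma spectral_radius_smult_le:
  fixes A :: "complex mat"
  assumes A: "A \<in> carrier_mat n n" and n: "n > 0"
  shows "spectral_radius (c \<cdot>\<^sub>m A) \<le> norm c * spectral_radius A"
proof -
  have cA: "c \<cdot>\<^sub>m A \<in> carrier_mat n n" using A by simp
  obtain k where k: "eigenvalue (c \<cdot>\<^sub>m A) k" and sr: "spectral_radius (c \<cdot>\<^sub>m A) = norm k"
    using spectral_radius_mem_max(1)[OF cA n] by (auto simp: spectrum_def)
  show ?thesis
  proof (cases "k = 0")
    case True
    then show ?thesis using sr spectral_radius_nonneg[OF A n] by simp
  next
    case False
    obtain v where v: "v \<in> carrier_vec n" "v \<noteq> 0\<^sub>v n" "(c \<cdot>\<^sub>m A) *\<^sub>v v = k \<cdot>\<^sub>v v"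
      using k A unfolding eigenvalue_def eigenvector_def by auto
    have eq: "c \<cdot>\<^sub>v (A *\<^sub>v v) = k \<cdot>\<^sub>v v"
      unfolding v(3)[symmetric] using v(1) A
      by (intro eq_vecI) (auto simp: scalar_prod_def sum_distrib_left mult.assoc)
    obtain l where "l < n" "v $ l \<noteq> 0" using v(1,2) by (auto simp: vec_eq_iff)
    then have c: "c \<noteq> 0"
      using arg_cong[OF eq, of "\<lambda>w. w $ l"] v(1) A False by auto
    have "A *\<^sub>v v = (inverse c * c) \<cdot>\<^sub>v (A *\<^sub>v v)" using c by simp
    also have "\<dots> = inverse c \<cdot>\<^sub>v (k \<cdot>\<^sub>v v)" by (simp only: eq smult_smult_assoc[symmetric])
    also have "\<dots> = (k / c) \<cdot>\<^sub>v v" by (simp add: smult_smult_assoc divide_inverse mult.commute)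
    finally have "eigenvalue A (k / c)"
      using v A unfolding eigenvalue_def eigenvector_def by auto
    then have "norm (k / c) \<le> spectral_radius A"
      by (intro spectral_radius_mem_max(2)[OF A n]) (auto simp: spectrum_def)
    then show ?thesis using c sr by (simp add: norm_divide field_simps)
  qed
qed

text \<open>Matrix powers unfold with the new factor on the right, whereas a recursion applies its
  matrix on the left.\<close>

lemma mat_pow_Suc_left:
  fixes A :: "'a :: semiring_1 mat"
  assumes "A \<in> carrier_mat n n"
  shows "A ^\<^sub>m Suc k = A * A ^\<^sub>m k"
proof (induction k)
  case 0
  then show ?case using assms by simp
next
  case (Suc k)
  have "A ^\<^sub>m Suc (Suc k) = (A * A ^\<^sub>m k) * A" using Suc by simp
  also have "\<dots> = A * A ^\<^sub>m Suc k"
    using assms by (simp add: assoc_mult_mat[of _ n n _ n _ n])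
  finally show ?case .
qed

lemma nonneg_recursion_le_pow:
  fixes Z :: "real mat" and u :: "nat \<Rightarrow> nat \<Rightarrow> real"
  assumes Z: "Z \<in> carrier_mat n n"
    and nonneg: "\<And>i j. i < n \<Longrightarrow> j < n \<Longrightarrow> Z $$ (i, j) \<ge> 0"
    and rec: "\<And>t i. i < n \<Longrightarrow> u (Suc t) i \<le> (\<Sum>j<n. Z $$ (i, j) * u t j)"
  shows "i < n \<Longrightarrow> u t i \<le> (\<Sum>j<n. (Z ^\<^sub>m t) $$ (i, j) * u 0 j)"
proof (induction t arbitrary: i)
  case 0
  then show ?case using Z by (simp add: if_distrib[of "\<lambda>x. x * _"] cong: if_cong)
next
  case (Suc t)
  have "u (Suc t) i \<le> (\<Sum>l<n. Z $$ (i, l) * u t l)" using rec Suc.prems by simp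
  also have "\<dots> \<le> (\<Sum>l<n. Z $$ (i, l) * (\<Sum>j<n. (Z ^\<^sub>m t) $$ (l, j) * u 0 j))"
    using Suc nonneg by (intro sum_mono mult_left_mono) auto
  also have "\<dots> = (\<Sum>j<n. (\<Sum>l<n. Z $$ (i, l) * (Z ^\<^sub>m t) $$ (l, j)) * u 0 j)"
    unfolding sum_distrib_left sum_distrib_right by (subst sum.swap) (simp add: mult.assoc)
  also have "\<dots> = (\<Sum>j<n. (Z ^\<^sub>m Suc t) $$ (i, j) * u 0 j)"
    unfolding mat_pow_Suc_left[OF Z] using Z Suc.prems pow_carrier_mat[OF Z, of t]
    by (intro sum.cong refl) (auto simp: scalar_prod_def atLeast0LessThan)
  finally show ?case .
qed

text \<open>Dividing \<open>Z\<close> by \<open>r\<close> brings the spectral radius strictly below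
  1, so all powers of the rescaled matrix are uniformly bounded. At \<open>r = lambda_max Z\<close>
  itself, Jordan blocks could contribute polynomial factors.\<close>

lemma nonneg_recursion_growth:
  fixes Z :: "real mat" and u :: "nat \<Rightarrow> nat \<Rightarrow> real"
  assumes Z: "Z \<in> carrier_mat n n"
    and nonneg: "\<And>i j. i < n \<Longrightarrow> j < n \<Longrightarrow> Z $$ (i, j) \<ge> 0"
    and rec: "\<And>t i. i < n \<Longrightarrow> u (Suc t) i \<le> (\<Sum>j<n. Z $$ (i, j) * u t j)"
    and r: "lambda_max Z < r"
  obtains C where "\<And>t i. i < n \<Longrightarrow> u t i \<le> C * r ^ t"
proof (cases "n = 0")
  case True
  then show ?thesis using that by simp
next
  case False
  let ?c = "map_mat complex_of_real"
  have cZ: "?c Z \<in> carrier_mat n n" using Z by simp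
  have r0: "r > 0"
    using spectral_radius_nonneg[OF cZ] False r by (simp add: lambda_max_def)
  define Y where "Y = inverse r \<cdot>\<^sub>m Z"
  have Y: "Y \<in> carrier_mat n n" using Z by (simp add: Y_def)
  have cY: "?c Y = complex_of_real (inverse r) \<cdot>\<^sub>m ?c Z" by (auto simp: Y_def)
  have "spectral_radius (?c Y) \<le> inverse r * lambda_max Z"
    using spectral_radius_smult_le[OF cZ, of "complex_of_real (inverse r)"] False r0
    unfolding cY lambda_max_def by (simp add: norm_inverse)
  also have "\<dots> < 1" using r r0 by (simp add: field_simps)
  finally obtain c where "\<And>k. norm_bound (?c Y ^\<^sub>m k) c"
    using spectral_radius_jnf_norm_bound_less_1_upper_triangular[of "?c Y" n] Y by auto
  then have nb: "norm_bound (?c (Y ^\<^sub>m k)) c" for k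
    by (simp add: of_real_hom.mat_hom_pow[OF Y])
  have bound: "\<bar>(Y ^\<^sub>m k) $$ (i, j)\<bar> \<le> c" if "i < n" "j < n" for i j k
  proof -
    have "dim_row (Y ^\<^sub>m k) = n" "dim_col (Y ^\<^sub>m k) = n"
      using pow_carrier_mat[OF Y, of k] by (blast dest: carrier_matD)+
    then show ?thesis
      using nb[of k, unfolded norm_bound_def, rule_format, of i j] that
      by (simp only: index_map_mat norm_of_real)
  qed
  define w where "w t i = u t i / r ^ t" for t i
  have "w (Suc t) i \<le> (\<Sum>j<n. Y $$ (i, j) * w t j)" if "i < n" for t i
  proof -
    have "w (Suc t) i \<le> (\<Sum>j<n. Z $$ (i, j) * u t j) / r ^ Suc t"
      unfolding w_def using rec[OF that] r0 by (intro divide_right_mono) auto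
    also have "\<dots> = (\<Sum>j<n. Y $$ (i, j) * w t j)"
      unfolding sum_divide_distrib using Z that
      by (intro sum.cong refl) (auto simp: Y_def w_def divide_inverse mult_ac)
    finally show ?thesis .
  qed
  then have pow: "w t i \<le> (\<Sum>j<n. (Y ^\<^sub>m t) $$ (i, j) * w 0 j)" if "i < n" for t i
    using that Z nonneg r0 by (intro nonneg_recursion_le_pow[OF Y]) (auto simp: Y_def)
  \<comment> \<open>The initial values may have any sign, so the constant takes their absolute
    values.\<close>
  have "u t i \<le> (\<Sum>j<n. c * \<bar>w 0 j\<bar>) * r ^ t" if "i < n" for t i
  proof -
    have "w t i \<le> (\<Sum>j<n. (Y ^\<^sub>m t) $$ (i, j) * w 0 j)" by (rule pow[OF that])
    also have "\<dots> \<le> (\<Sum>j<n. c * \<bar>w 0 j\<bar>)"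
    proof (rule sum_mono)
      fix j assume "j \<in> {..<n}"
      then have "\<bar>(Y ^\<^sub>m t) $$ (i, j)\<bar> * \<bar>w 0 j\<bar> \<le> c * \<bar>w 0 j\<bar>"
        using bound that by (intro mult_right_mono) auto
      then show "(Y ^\<^sub>m t) $$ (i, j) * w 0 j \<le> c * \<bar>w 0 j\<bar>"
        by (metis abs_ge_self abs_mult order_trans)
    qed
    finally show ?thesis using r0 by (simp add: w_def field_simps)
  qed
  then show ?thesis by (rule that)
qed

lemma limsup_root_le:
  fixes f :: "nat \<Rightarrow> real"
  assumes f: "\<And>t. f t \<ge> 0" "\<And>t. f t \<le> C * r ^ t" and r: "r > 0"
  shows "limsup (\<lambda>t. ennreal (f t powr (1 / real t))) \<le> ennreal r"
proof -
  \<comment> \<open>\<open>C\<close> may be 0; a positive constant has \<open>t\<close>-th roots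
    tending to 1. The exponent at \<open>t = 0\<close> is the default \<open>1 / 0 = 0\<close>, so
    the estimate is made for positive \<open>t\<close> only.\<close>
  define K where "K = max C 1"
  have K: "K > 0" and CK: "C \<le> K" by (auto simp: K_def)
  have le: "f t powr (1 / real t) \<le> K powr (1 / real t) * r" if "t > 0" for t
  proof -
    have "f t \<le> K * r ^ t"
      using f(2)[of t] CK r by (meson mult_right_mono order_trans zero_le_power less_imp_le)
    then have "f t powr (1 / real t) \<le> (K * r ^ t) powr (1 / real t)"
      using f(1) by (intro powr_mono2) auto
    also have "\<dots> = K powr (1 / real t) * r"
      using K r that by (simp add: powr_mult powr_powr flip: powr_realpow)
    finally show ?thesis .
  qed
  have "(\<lambda>t. 1 / real t) \<longlonglongrightarrow> 0" by (rule lim_1_over_n)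
  then have "(\<lambda>t. K powr (1 / real t) * r) \<longlonglongrightarrow> K powr 0 * r"
    using K by (intro tendsto_intros) auto
  then have lim: "(\<lambda>t. ennreal (K powr (1 / real t) * r)) \<longlonglongrightarrow> ennreal r"
    using K by (intro tendsto_ennrealI) simp
  have "limsup (\<lambda>t. ennreal (f t powr (1 / real t)))
      \<le> limsup (\<lambda>t. ennreal (K powr (1 / real t) * r))"
    by (intro Limsup_mono eventually_mono[OF eventually_gt_at_top[of 0]] ennreal_leI le)
  also have "\<dots> = ennreal r" using lim by (intro lim_imp_Limsup) auto
  finally show ?thesis .
qed

section \<open>Contraction over nested sets\<close>

lemma nested_subset:
  fixes N :: "nat \<Rightarrow> 'a set"
  assumes "k \<le> l" "l \<le> T" "\<And>k. k < T \<Longrightarrow> N k \<subseteq> N (Suc k)"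
  shows "N k \<subseteq> N l"
  using assms(1,2)
proof (induction l rule: dec_induct)
  case (step l)
  then show ?case using assms(3)[of l] by auto
qed simp

text \<open>Since \<open>p \<le> q \<le> r\<close>, shifting weight towards the inner sets only
  lowers the bound; the worst case has weight exactly \<open>a\<close> on \<open>P\<close> and
  \<open>a + b\<close> on \<open>Q\<close>.\<close>

lemma convex_combination_le_nested:
  fixes w x :: "'a \<Rightarrow> real"
  assumes fin: "finite R" and sub: "P \<subseteq> Q" "Q \<subseteq> R"
    and w: "\<And>j. j \<in> R \<Longrightarrow> w j \<ge> 0" "sum w R = 1"
    and wP: "sum w P \<ge> a" and wQ: "sum w Q \<ge> a + b"
    and x: "\<And>j. j \<in> P \<Longrightarrow> x j \<le> p" "\<And>j. j \<in> Q \<Longrightarrow> x j \<le> q" "\<And>j. j \<in> R \<Longrightarrow> x j \<le> r"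
    and pqr: "p \<le> q" "q \<le> r"
  shows "(\<Sum>j\<in>R. w j * x j) \<le> a * p + b * q + (1 - a - b) * r"
proof -
  have finQ: "finite Q" using fin sub finite_subset by blast
  have split: "(\<Sum>j\<in>R. g j) = sum g P + sum g (Q - P) + sum g (R - Q)" for g :: "'a \<Rightarrow> real"
    using sum.subset_diff[OF sub(2) fin, of g] sum.subset_diff[OF sub(1) finQ, of g] by simp
  have part: "(\<Sum>j\<in>S. w j * x j) \<le> sum w S * m"
    if "S \<subseteq> R" "\<And>j. j \<in> S \<Longrightarrow> x j \<le> m" for S m
    unfolding sum_distrib_right using that w by (intro sum_mono mult_left_mono) auto
  have QP: "sum w Q = sum w P + sum w (Q - P)"
    using sum.subset_diff[OF sub(1) finQ, of w] by simp
  have RQ: "1 = sum w Q + sum w (R - Q)"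
    using sum.subset_diff[OF sub(2) fin, of w] w(2) by simp
  have "(\<Sum>j\<in>R. w j * x j) \<le> sum w P * p + sum w (Q - P) * q + sum w (R - Q) * r"
    unfolding split using sub x by (intro add_mono part) auto
  also have "\<dots> = sum w P * p + (sum w Q - sum w P) * q + (1 - sum w Q) * r"
    using QP RQ by simp
  \<comment> \<open>Summation by parts: each surplus of weight is multiplied by a nonnegative gap,
    \<open>q - p\<close> or \<open>r - q\<close>.\<close>
  also have "\<dots> = a * p + b * q + (1 - a - b) * r
      - (sum w P - a) * (q - p) - (sum w Q - (a + b)) * (r - q)"
    by (simp add: algebra_simps)
  also have "\<dots> \<le> a * p + b * q + (1 - a - b) * r"
    using wP wQ pqr by (smt (verit) mult_nonneg_nonneg)
  finally show ?thesis .
qed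

text \<open>An agent satisfies the bound at the level where it first enters the chain, and the bound
  grows with the level because the maxima do. Treating maxima alone suffices: applied to
  \<open>-x\<close>, the same bound controls the minima.\<close>

lemma Max_le_nested_step:
  fixes w :: "nat \<Rightarrow> nat \<Rightarrow> real" and x :: "nat \<Rightarrow> real"
  assumes w: "\<And>i j. i < n \<Longrightarrow> j < n \<Longrightarrow> w i j \<ge> 0" "\<And>i. i < n \<Longrightarrow> (\<Sum>j<n. w i j) = 1"
    and ab: "a \<ge> 0" "b \<ge> 0"
    and NT: "N T = {..<n}" and N0: "N 0 = {i0}"
    and mono: "\<And>k. k < T \<Longrightarrow> N k \<subseteq> N (Suc k)"
    and self: "w i0 i0 \<ge> a + b"
    and inner: "\<And>k i. k < T \<Longrightarrow> i \<in> N (Suc k) - N k \<Longrightarrow> (\<Sum>j\<in>N k. w i j) \<ge> a"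
    and outer: "\<And>k i. k < T \<Longrightarrow> i \<in> N (Suc k) - N k \<Longrightarrow> (\<Sum>j\<in>N (Suc k). w i j) \<ge> a + b"
    and k: "k < T"
  shows "(MAX i\<in>N (Suc k). \<Sum>j<n. w i j * x j)
    \<le> a * (MAX i\<in>N k. x i) + b * (MAX i\<in>N (Suc k). x i) + (1 - a - b) * (MAX i\<in>{..<n}. x i)"
proof -
  have chain: "N k \<subseteq> N l" if "k \<le> l" "l \<le> T" for k l
    by (rule nested_subset) (use that mono in auto)
  have sub: "N k \<subseteq> {..<n}" if "k \<le> T" for k using chain[OF that] NT by simp
  have fin: "finite (N k)" if "k \<le> T" for k using sub[OF that] finite_subset by blast
  have ne: "N k \<noteq> {}" if "k \<le> T" for k using chain[of 0 k] that N0 by auto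
  define X where "X k = (MAX i\<in>N k. x i)" for k
  have X_ge: "x i \<le> X k" if "i \<in> N k" "k \<le> T" for i k
    unfolding X_def using that fin by (intro Max_ge) auto
  have X_mono: "X k \<le> X l" if "k \<le> l" "l \<le> T" for k l
    unfolding X_def using that chain fin ne by (intro Max_mono image_mono) auto
  \<comment> \<open>At \<open>k = 0\<close> the truncated subtraction \<open>0 - 1 = 0\<close> makes the bound the one given by \<open>self\<close>.\<close>
  have bound: "(\<Sum>j<n. w i j * x j) \<le> a * X (k - 1) + b * X k + (1 - a - b) * X T"
    if "k \<le> T" "i \<in> N k" for k i
    using that
  proof (induction k)
    case 0
    then have "i = i0" "i0 < n" using N0 sub[of 0] by auto
    then show ?case
      using self ab w N0 X_ge[of _ 0] X_ge[of _ T] X_mono[of 0 T] NT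
      by (intro convex_combination_le_nested[where P = "N 0" and Q = "N 0"]) auto
  next
    case (Suc k)
    show ?case
    proof (cases "i \<in> N k")
      case True
      have "a * X (k - 1) + b * X k \<le> a * X k + b * X (Suc k)"
        using ab Suc.prems by (intro add_mono mult_left_mono X_mono) auto
      then show ?thesis using Suc True by fastforce
    next
      case False
      have "i < n" using Suc.prems sub by auto
      then show ?thesis
        using Suc.prems False w inner[of k i] outer[of k i] mono[of k] sub[of "Suc k"]
          X_ge[of _ k] X_ge[of _ "Suc k"] X_ge[of _ T] X_mono[of k "Suc k"] X_mono[of "Suc k" T] NT
        by (intro convex_combination_le_nested[where P = "N k" and Q = "N (Suc k)"]) auto
    qed
  qed
  have "(MAX i\<in>N (Suc k). \<Sum>j<n. w i j * x j) \<le> a * X k + b * X (Suc k) + (1 - a - b) * X T"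
    using k fin[of "Suc k"] ne[of "Suc k"] bound[of "Suc k"] by (subst Max_le_iff) auto
  then show ?thesis by (simp add: X_def NT)
qed

section \<open>The matrix of the comparison system\<close>

lemma zeta_carrier: "zeta T a b \<in> carrier_mat T T"
  unfolding zeta_def subdiag_mat_def by (intro add_carrier_mat smult_carrier_mat) auto

lemma zeta_index:
  assumes "i < T" "j < T"
  shows "zeta T a b $$ (i, j) = (if j = T - 1 then 1 - a - b else 0)
    + (if i = j then b else 0) + (if i = Suc j then a else 0)"
  using assms
  by (auto simp: zeta_def subdiag_mat_def mat_of_cols_def mat_of_rows_def scalar_prod_def)

text \<open>Row \<open>i\<close> encodes the inequality for level \<open>i + 1\<close>, and column
  \<open>T - 1\<close> stands for the whole agent set. Row 0 has no subdiagonal term because the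
  spread over \<open>N 0\<close> vanishes.\<close>

lemma sum_zeta:
  assumes "i < T"
  shows "(\<Sum>j<T. zeta T a b $$ (i, j) * u j)
    = (if i = 0 then 0 else a * u (i - 1)) + b * u i + (1 - a - b) * u (T - 1)"
proof -
  have "(\<Sum>j<T. zeta T a b $$ (i, j) * u j)
      = (\<Sum>j<T. (if j = T - 1 then (1 - a - b) * u j else 0)
        + (if j = i then b * u j else 0) + (if i \<noteq> 0 \<and> j = i - 1 then a * u j else 0))"
    using assms by (intro sum.cong refl) (auto simp: zeta_index algebra_simps)
  also have "\<dots> = (if i = 0 then 0 else a * u (i - 1)) + b * u i + (1 - a - b) * u (T - 1)"
    using assms by (cases "i = 0") (auto simp: sum.distrib)
  finally show ?thesis .
qed

text \<open>Two maxima allow the one-sided step bound to be added to itself.\<close>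

lemma spread_eq:
  assumes "n > 0"
  shows "spread n v = (MAX i\<in>{..<n}. v $ i) + (MAX i\<in>{..<n}. - v $ i)"
proof -
  have "(MAX i\<in>{..<n}. - v $ i) = - (MIN i\<in>{..<n}. v $ i)"
    using assms by (subst minus_Min_eq_Max) (auto simp: image_image lessThan_empty_iff)
  then show ?thesis by (simp add: spread_def)
qed

theorem theorem3:
  fixes n T\<^sub>d :: nat
    and A :: "nat \<Rightarrow> real mat"
    and N :: "nat \<Rightarrow> nat set"
    and \<alpha> \<beta> \<gamma> \<alpha>' \<beta>' :: real
  assumes "n \<ge> 1"
    and "\<And>t. row_stochastic n (A t)"
    and "T\<^sub>d > 0"
    and "\<alpha> \<ge> 0" and "\<beta> \<ge> 0" and "\<gamma> \<ge> 0"
    and "is_singleton (N 0)"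
    and "\<And>k. k \<in> {1..T\<^sub>d} \<Longrightarrow> N (k - 1) \<subseteq> N k"
    and "N T\<^sub>d = {..<n}"
    and "\<And>t i. i \<in> N 0 \<Longrightarrow> A t $$ (i, i) \<ge> \<alpha>"
    and "\<And>t k i. k \<in> {1..T\<^sub>d} \<Longrightarrow> i \<in> N k - N (k - 1) \<Longrightarrow>
           (\<Sum>j\<in>N k - N (k - 1). A t $$ (i, j)) \<ge> \<beta>"
    and "\<And>t k i. k \<in> {1..T\<^sub>d} \<Longrightarrow> i \<in> N k - N (k - 1) \<Longrightarrow>
           (\<Sum>j\<in>N (k - 1). A t $$ (i, j)) \<ge> \<gamma>"
    and "\<alpha>' = min \<alpha> \<gamma>"
    and "\<beta>' = min (\<beta> + \<gamma>) \<alpha> - \<alpha>'"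
  shows "contraction_rate n A \<le> ennreal (lambda_max (zeta T\<^sub>d \<alpha>' \<beta>'))"
proof -
  let ?Z = "zeta T\<^sub>d \<alpha>' \<beta>'"
  have A: "A t \<in> carrier_mat n n" "\<And>i j. i < n \<Longrightarrow> j < n \<Longrightarrow> A t $$ (i, j) \<ge> 0"
    "\<And>i. i < n \<Longrightarrow> (\<Sum>j<n. A t $$ (i, j)) = 1" for t
    using assms(2)[of t] by (auto simp: row_stochastic_def)
  \<comment> \<open>Here \<open>\<alpha>' + \<beta>'\<close> is
    \<open>min (\<beta> + \<gamma>) \<alpha>\<close>, a lower bound both for the self-weight in
    \<open>N 0\<close> and for the weight that a new agent of \<open>N k\<close> puts on
    \<open>N k\<close>.\<close>
  have ab: "\<alpha>' \<ge> 0" "\<beta>' \<ge> 0" "\<alpha>' \<le> \<gamma>" "\<alpha>' + \<beta>' \<le> \<alpha>" "\<alpha>' + \<beta>' \<le> \<beta> + \<gamma>"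
    using assms(4-6,13,14) by auto
  have mono: "N k \<subseteq> N (Suc k)" if "k < T\<^sub>d" for k using assms(8)[of "Suc k"] that by simp
  obtain i0 where N0: "N 0 = {i0}" using assms(7) by (auto simp: is_singleton_def)
  have chain: "N k \<subseteq> N l" if "k \<le> l" "l \<le> T\<^sub>d" for k l
    by (rule nested_subset) (use that mono in auto)
  have sub: "N k \<subseteq> {..<n}" if "k \<le> T\<^sub>d" for k using chain[OF that] assms(9) by simp
  have i0: "i0 < n" using sub[of 0] N0 by simp
  have self: "A t $$ (i0, i0) \<ge> \<alpha>' + \<beta>'" for t
    using assms(10)[of i0 t] N0 ab by simp
  \<comment> \<open>A single entry of a stochastic row is at most 1. This makes the coefficient
    \<open>1 - \<alpha>' - \<beta>'\<close> in the last column of \<open>zeta\<close>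
    nonnegative.\<close>
  have "A 0 $$ (i0, i0) \<le> (\<Sum>j<n. A 0 $$ (i0, j))"
    using i0 A(2)[of _ _ 0] by (intro member_le_sum) auto
  then have ab1: "\<alpha>' + \<beta>' \<le> 1" using self[of 0] A(3)[OF i0, of 0] by simp
  have inner: "(\<Sum>j\<in>N k. A t $$ (i, j)) \<ge> \<alpha>'" if "k < T\<^sub>d" "i \<in> N (Suc k) - N k" for t k i
    using assms(12)[of "Suc k" i t] that ab by simp
  have outer: "(\<Sum>j\<in>N (Suc k). A t $$ (i, j)) \<ge> \<alpha>' + \<beta>'"
    if "k < T\<^sub>d" "i \<in> N (Suc k) - N k" for t k i
  proof -
    have "finite (N (Suc k))" using sub[of "Suc k"] that finite_subset by fastforce
    from sum.subset_diff[OF mono[OF that(1)] this, of "\<lambda>j. A t $$ (i, j)"]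
    show ?thesis using assms(11)[of "Suc k" i t] assms(12)[of "Suc k" i t] that ab by simp
  qed
  have Znn: "?Z $$ (i, j) \<ge> 0" if "i < T\<^sub>d" "j < T\<^sub>d" for i j
    using that ab ab1 by (simp add: zeta_index)
  have lam0: "lambda_max ?Z \<ge> 0"
    unfolding lambda_max_def using assms(3) zeta_carrier
    by (intro spectral_radius_nonneg[of _ T\<^sub>d]) auto
  \<comment> \<open>The growth estimate requires a rate strictly above the spectral radius; the
    final step takes \<open>r\<close> to be the spectral radius plus an arbitrary positive
    \<open>e\<close>.\<close>
  have main: "limsup (\<lambda>t. ennreal ((spread n (trajectory A x0 t) / spread n x0) powr (1 / real t)))
      \<le> ennreal r"
    if x0: "x0 \<in> carrier_vec n" "spread n x0 \<noteq> 0" and r: "lambda_max ?Z < r" for x0 r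
  proof -
    define x where "x t i = trajectory A x0 t $ i" for t i
    have carr: "trajectory A x0 t \<in> carrier_vec n" for t
      using x0 mult_mat_vec_carrier[OF A(1)] by (induction t) auto
    have step: "x (Suc t) i = (\<Sum>j<n. A t $$ (i, j) * x t j)" if "i < n" for t i
      using that A(1)[of t] carr[of t] by (auto simp: x_def scalar_prod_def atLeast0LessThan)
    define D where "D t k = (MAX i\<in>N k. x t i) + (MAX i\<in>N k. - x t i)" for t k
    have D0: "D t 0 = 0" for t by (simp add: D_def N0)
    have D_step: "D (Suc t) (Suc k)
        \<le> \<alpha>' * D t k + \<beta>' * D t (Suc k) + (1 - \<alpha>' - \<beta>') * D t T\<^sub>d" if k: "k < T\<^sub>d" for t k
    proof -
      have in_n: "i < n" if "i \<in> N (Suc k)" for i using sub[of "Suc k"] k that by auto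
      note M = Max_le_nested_step[where w = "\<lambda>i j. A t $$ (i, j)",
          OF A(2,3) ab(1,2) assms(9) N0 mono self inner outer k]
      have "(MAX i\<in>N (Suc k). x (Suc t) i) \<le> \<alpha>' * (MAX i\<in>N k. x t i)
          + \<beta>' * (MAX i\<in>N (Suc k). x t i) + (1 - \<alpha>' - \<beta>') * (MAX i\<in>N T\<^sub>d. x t i)"
        using M[of "x t"] in_n by (simp add: step assms(9) cong: image_cong_simp)
      moreover have "(MAX i\<in>N (Suc k). - x (Suc t) i) \<le> \<alpha>' * (MAX i\<in>N k. - x t i)
          + \<beta>' * (MAX i\<in>N (Suc k). - x t i) + (1 - \<alpha>' - \<beta>') * (MAX i\<in>N T\<^sub>d. - x t i)"
        using M[of "\<lambda>i. - x t i"] in_n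
        by (simp add: step assms(9) sum_negf cong: image_cong_simp)
      ultimately show ?thesis by (simp add: D_def algebra_simps)
    qed
    \<comment> \<open>Matrix index \<open>i\<close> carries level \<open>Suc i\<close>;
      \<open>D0\<close> accounts for the missing term at \<open>i = 0\<close>.\<close>
    have "D (Suc t) (Suc i) \<le> (\<Sum>j<T\<^sub>d. ?Z $$ (i, j) * D t (Suc j))" if "i < T\<^sub>d" for t i
      using D_step[OF that, of t] that D0 by (auto simp: sum_zeta)
    from nonneg_recursion_growth[where u = "\<lambda>t i. D t (Suc i)", OF zeta_carrier Znn this r]
    obtain C where C: "\<And>t i. i < T\<^sub>d \<Longrightarrow> D t (Suc i) \<le> C * r ^ t" by blast
    have sp: "spread n (trajectory A x0 t) = D t T\<^sub>d" for t
      using assms(1) by (simp add: spread_eq D_def assms(9) x_def)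
    have sp_nonneg: "spread n v \<ge> 0" for v
    proof -
      have "(MIN i\<in>{..<n}. v $ i) \<le> v $ i0" using i0 by (intro Min_le) auto
      also have "\<dots> \<le> (MAX i\<in>{..<n}. v $ i)" using i0 by (intro Max_ge) auto
      finally show ?thesis by (simp add: spread_def)
    qed
    show ?thesis
    proof (rule limsup_root_le)
      show "spread n (trajectory A x0 t) / spread n x0 \<ge> 0" for t
        using sp_nonneg by simp
      show "spread n (trajectory A x0 t) / spread n x0 \<le> (C / spread n x0) * r ^ t" for t
      proof -
        have "D t T\<^sub>d \<le> C * r ^ t" using C[of "T\<^sub>d - 1" t] assms(3) by simp
        then have "D t T\<^sub>d / spread n x0 \<le> C * r ^ t / spread n x0"
          using sp_nonneg by (rule divide_right_mono)
        then show ?thesis by (simp only: sp times_divide_eq_left)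
      qed
      show "r > 0" using lam0 r by simp
    qed
  qed
  show ?thesis
    unfolding contraction_rate_def
  proof (rule SUP_least, rule ennreal_le_epsilon)
    fix x0 and e :: real
    assume x0: "x0 \<in> {x0 \<in> carrier_vec n. spread n x0 \<noteq> 0}" and e: "0 < e"
    show "limsup (\<lambda>t. ennreal ((spread n (trajectory A x0 t) / spread n x0) powr (1 / real t)))
        \<le> ennreal (lambda_max ?Z) + ennreal e"
      using main[of x0 "lambda_max ?Z + e"] x0 e unfolding ennreal_plus[OF lam0 less_imp_le[OF e]]
      by simp
  qed
qed

end
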